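(* Let $P:=\operatorname{conv}\{(0,0,0),(0,0,6),(0,6,0),(6,0,0)\}\subset\mathbb{R}^3$. Then the set $\mathcal{D}_{42}(P\cap\mathbb{Z}^3)$ is not the set of lattice points of a convex lattice polytope. Moreover, not every lattice point of $\operatorname{conv}\mathcal{D}_{42}(\mathbb{N}^3)$ can be written as a sum of $42$ distinct lattice points in $\mathbb{N}^3$.
   Context: $\mathbb{N}=\mathbb{Z}_{\geq 0}$. For a subset $S\subseteq\mathbb{Z}^n$ and an integer $p\ge 0$, the $p$-th distinct sum set of $S$ is $\mathcal{D}_pS:=\{\sum_{m\in T}m \mid T\subseteq S,\ \#T=p\}$. A lattice point is a point with integer coordinates. A (convex) lattice polytope is the convex hull of a nonempty finite set of lattice points in Euclidean space. $\operatorname{conv}$ denotes the convex hull. *)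

theory Defs
  imports "HOL-Analysis.Analysis"
begin

definition lattice_points :: "(real ^ 'n) set" where
  "lattice_points = {x. \<forall>i. x $ i \<in> \<int>}"

definition nat_points :: "(real ^ 'n) set" where
  "nat_points = {x. \<forall>i. x $ i \<in> \<nat>}"

(* Finiteness of T matters only for p = 0, since infinite sets have cardinality 0. *)
definition distinct_sum_set :: "nat \<Rightarrow> 'a::comm_monoid_add set \<Rightarrow> 'a set" where
  "distinct_sum_set p S = {\<Sum>m\<in>T. m | T. T \<subseteq> S \<and> finite T \<and> card T = p}"

definition lattice_polytope :: "(real ^ 'n) set \<Rightarrow> bool" where
  "lattice_polytope Q \<longleftrightarrow>
     (\<exists>V. finite V \<and> V \<noteq> {} \<and> V \<subseteq> lattice_points \<and> Q = convex hull V)"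

end

theory Submission
  imports Defs
begin

text \<open>
  One lattice point disproves both claims. The weight \<open>4a + 5b + 7c\<close> takes values below 25 at
  exactly 40 points of \<open>\<nat>\<^sup>3\<close> and the value 25 at exactly four points, which form the vertices
  \<open>A = (0,5,0)\<close>, \<open>B = (1,0,3)\<close>, \<open>D = (5,1,0)\<close> and the centroid \<open>C = (2,2,1)\<close> of a triangle;
  all 44 points lie in the simplex \<open>P\<close>.

  A sum of 42 distinct points of \<open>\<nat>\<^sup>3\<close> of the least possible weight must consist of the 40 light
  points, with sum \<open>s\<close> say, and of two of the four points of weight 25
  (\<open>subset_of_equal_sum\<close>). On this face of \<open>conv \<D>\<^sub>4\<^sub>2\<close> the problem therefore is that of sums of two
  distinct points among \<open>A, B, C, D\<close>. None of the six such sums is \<open>2C\<close>, whereas \<open>2C\<close> is the mean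
  of \<open>C + A\<close>, \<open>C + B\<close> and \<open>C + D\<close>. So \<open>s + 2C\<close> is a lattice point of \<open>conv \<D>\<^sub>4\<^sub>2(P \<inter> \<int>\<^sup>3)\<close>
  (\<open>gap_point_in_hull\<close>), but not a sum of 42 distinct points of \<open>\<nat>\<^sup>3\<close>
  (\<open>gap_point_not_distinct_sum\<close>). Since any convex set that contains \<open>\<D>\<^sub>4\<^sub>2(P \<inter> \<int>\<^sup>3)\<close>
  contains its hull, both claims follow.
\<close>

section \<open>Distinct sum sets\<close>

lemma distinct_sum_set_mono:
  "S \<subseteq> S' \<Longrightarrow> distinct_sum_set p S \<subseteq> distinct_sum_set p S'"
  unfolding distinct_sum_set_def by blast

lemma distinct_sum_set_image:
  fixes h :: "'a::comm_monoid_add \<Rightarrow> 'b::comm_monoid_add"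
  assumes "inj_on h S" and zero: "h 0 = 0" and add: "\<And>x y. h (x + y) = h x + h y"
  shows "distinct_sum_set p (h ` S) = h ` distinct_sum_set p S"
proof -
  have sum: "h (\<Sum>m\<in>U. m) = (\<Sum>m\<in>h ` U. m)" and card: "card (h ` U) = card U"
    and fin: "finite (h ` U) \<longleftrightarrow> finite U" if "U \<subseteq> S" for U
  proof -
    have inj: "inj_on h U" using assms(1) that by (rule inj_on_subset)
    have "h (\<Sum>m\<in>U. m) = (\<Sum>m\<in>U. h m)"
      by (induction U rule: infinite_finite_induct) (auto simp: zero add)
    then show "h (\<Sum>m\<in>U. m) = (\<Sum>m\<in>h ` U. m)" using inj by (simp add: sum.reindex)
    show "card (h ` U) = card U" using inj by (rule card_image)
    show "finite (h ` U) \<longleftrightarrow> finite U" using inj by (rule finite_image_iff)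
  qed
  show ?thesis
  proof (intro equalityI subsetI)
    fix x assume "x \<in> distinct_sum_set p (h ` S)"
    then obtain U where "U \<subseteq> S" "x = (\<Sum>m\<in>h ` U. m)" "finite (h ` U)" "card (h ` U) = p"
      unfolding distinct_sum_set_def by (auto simp: subset_image_iff)
    then have "x = h (\<Sum>m\<in>U. m)" and "(\<Sum>m\<in>U. m) \<in> distinct_sum_set p S"
      unfolding distinct_sum_set_def using sum card fin by auto
    then show "x \<in> h ` distinct_sum_set p S" by blast
  next
    fix x assume "x \<in> h ` distinct_sum_set p S"
    then obtain U where "U \<subseteq> S" "x = h (\<Sum>m\<in>U. m)" "finite U" "card U = p"
      unfolding distinct_sum_set_def by auto
    then show "x \<in> distinct_sum_set p (h ` S)"
      unfolding distinct_sum_set_def using sum card fin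
      by (intro CollectI exI[of _ "h ` U"]) auto
  qed
qed

text \<open>The set on which \<open>g\<close> is negative minimizes the sum of \<open>g\<close>, and a minimizer differs from it
  only by zeros of \<open>g\<close>: the sum over \<open>T - L\<close> is nonnegative and equals the sum over
  \<open>L - T\<close>, all of whose terms are negative.\<close>

lemma subset_of_equal_sum:
  fixes g :: "'a \<Rightarrow> 'b::linordered_idom"
  assumes fin: "finite T" "finite L"
    and neg: "\<And>x. x \<in> L \<Longrightarrow> g x < 0"
    and nonneg: "\<And>x. x \<in> T - L \<Longrightarrow> 0 \<le> g x"
    and eq: "sum g T = sum g L"
  shows "L \<subseteq> T" and "\<And>x. x \<in> T - L \<Longrightarrow> g x = 0"
proof -
  have "sum g T = sum g (T \<inter> L) + sum g (T - L)" and "sum g L = sum g (T \<inter> L) + sum g (L - T)"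
    using sum.Int_Diff[OF fin(1), of g L] sum.Int_Diff[OF fin(2), of g T]
    by (simp_all add: Int_commute)
  then have bal: "sum g (T - L) = sum g (L - T)" using eq by simp
  have ge: "0 \<le> sum g (T - L)" using nonneg by (rule sum_nonneg)
  have "L - T = {}"
  proof (rule ccontr)
    assume "L - T \<noteq> {}"
    then have "sum g (L - T) < sum (\<lambda>_. 0) (L - T)"
      using fin neg by (intro sum_strict_mono) auto
    then show False using bal ge by simp
  qed
  then show "L \<subseteq> T" by blast
  show "g x = 0" if "x \<in> T - L" for x
  proof -
    have "sum g (T - L) = 0" using bal \<open>L - T = {}\<close> by (metis sum.empty)
    then have "\<forall>x\<in>T - L. g x = 0"
      using sum_nonneg_eq_0_iff[of "T - L" g] fin nonneg by blast
    then show ?thesis using that by blast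
  qed
qed

section \<open>The face of weight 25\<close>

text \<open>The weight is shifted by 25, so that its sign tells the three kinds of points apart.\<close>

definition shifted_weight :: "nat \<times> nat \<times> nat \<Rightarrow> int" where
  "shifted_weight = (\<lambda>(a, b, c). 4 * int a + 5 * int b + 7 * int c - 25)"

definition light_points :: "(nat \<times> nat \<times> nat) set" where
  "light_points = {v. shifted_weight v < 0}"

definition gap_point :: "nat \<times> nat \<times> nat" where
  "gap_point = (\<Sum>m\<in>light_points. m) + (4, 4, 2)"

lemma light_points_eq:
  "light_points = set (filter (\<lambda>(a, b, c). 4 * a + 5 * b + 7 * c < 25)
     (List.product [0..<7] (List.product [0..<5] [0..<4])))"
  by (auto simp: light_points_def shifted_weight_def)

lemma finite_light_points: "finite light_points"
  by (simp add: light_points_eq)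

lemma card_light_points: "card light_points = 40"
proof -
  let ?xs = "filter (\<lambda>(a, b, c). 4 * a + 5 * b + 7 * c < (25::nat))
     (List.product [0..<7] (List.product [0..<5] [0..<4]))"
  have "distinct ?xs" by (intro distinct_filter distinct_product) simp_all
  moreover have "length ?xs = 40" by code_simp
  ultimately show ?thesis unfolding light_points_eq by (metis distinct_card)
qed

lemma shifted_weight_eq_0:
  "shifted_weight v = 0 \<longleftrightarrow> v \<in> {(0, 5, 0), (1, 0, 3), (2, 2, 1), (5, 1, 0)}"
proof
  assume w: "shifted_weight v = 0"
  obtain a b c where v: "v = (a, b, c)" by (cases v)
  have e: "4 * a + 5 * b + 7 * c = 25" using w by (simp add: v shifted_weight_def)
  then have "b \<in> {0, 1, 2, 3, 4, 5}" "c \<in> {0, 1, 2, 3}" by auto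
  then show "v \<in> {(0, 5, 0), (1, 0, 3), (2, 2, 1), (5, 1, 0)}"
    using e by (elim insertE emptyE; simp add: v; presburger)
qed (auto simp: shifted_weight_def)

lemma sum_shifted_weight:
  "finite U \<Longrightarrow>
    sum shifted_weight U = shifted_weight (\<Sum>m\<in>U. m) + 25 - 25 * int (card U)"
proof (induction U rule: finite_induct)
  case (insert v U)
  then show ?case
    by (cases v; cases "\<Sum>m\<in>U. m") (simp add: shifted_weight_def algebra_simps)
qed (simp add: shifted_weight_def zero_prod_def)

lemma gap_point_not_distinct_sum: "gap_point \<notin> distinct_sum_set 42 UNIV"
proof
  assume "gap_point \<in> distinct_sum_set 42 UNIV"
  then obtain T where T: "finite T" "card T = 42" "(\<Sum>m\<in>T. m) = gap_point"
    unfolding distinct_sum_set_def by auto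
  \<comment> \<open>\<open>T\<close> has two elements more than the set of light points, and \<open>(4, 4, 2)\<close> adds the weight 50;
    the shift by 25 per element makes the two sums agree.\<close>
  have "sum shifted_weight T = sum shifted_weight light_points"
    unfolding sum_shifted_weight[OF T(1)] sum_shifted_weight[OF finite_light_points] T
      card_light_points gap_point_def
    by (cases "\<Sum>m\<in>light_points. m") (simp add: shifted_weight_def)
  note rigid = subset_of_equal_sum[OF T(1) finite_light_points _ _ this]
  have sub: "light_points \<subseteq> T"
    by (rule rigid(1)) (auto simp: light_points_def)
  have zero: "shifted_weight x = 0" if "x \<in> T - light_points" for x
    by (rule rigid(2)[OF _ _ that]) (auto simp: light_points_def)
  have "card (T - light_points) = 2"
    using sub T card_light_points finite_light_points by (simp add: card_Diff_subset)
  then obtain u v where uv: "T - light_points = {u, v}" "u \<noteq> v"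
    by (auto simp: card_2_iff)
  have "(\<Sum>m\<in>T. m) = (\<Sum>m\<in>T - light_points. m) + (\<Sum>m\<in>light_points. m)"
    using sub T(1) by (rule sum.subset_diff)
  then have "u + v = (4, 4, 2)"
    using T(3) uv by (simp add: gap_point_def add.commute[of "u + v"])
  moreover have "u \<in> {(0, 5, 0), (1, 0, 3), (2, 2, 1), (5, 1, 0)}"
    and "v \<in> {(0, 5, 0), (1, 0, 3), (2, 2, 1), (5, 1, 0)}"
    using zero uv(1) shifted_weight_eq_0 by blast+
  ultimately show False using uv(2) by auto
qed

section \<open>Embedding into real space\<close>

definition real_vec :: "nat \<times> nat \<times> nat \<Rightarrow> real ^ 3" where
  "real_vec = (\<lambda>(a, b, c). vector [real a, real b, real c])"

lemma real_vec_nth [simp]: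
  "real_vec (a, b, c) $ 1 = real a" "real_vec (a, b, c) $ 2 = real b"
  "real_vec (a, b, c) $ 3 = real c"
  by (simp_all add: real_vec_def)

lemma inj_real_vec: "inj real_vec"
  by (auto simp: inj_def vec_eq_iff forall_3)

lemma real_vec_0: "real_vec 0 = 0"
  by (simp add: zero_prod_def vec_eq_iff forall_3)

lemma real_vec_add: "real_vec (u + v) = real_vec u + real_vec v"
  by (cases u; cases v) (simp add: vec_eq_iff forall_3)

lemma distinct_sum_set_real_vec:
  "distinct_sum_set p (real_vec ` S) = real_vec ` distinct_sum_set p S"
  using inj_real_vec real_vec_0 real_vec_add
  by (intro distinct_sum_set_image) (auto intro: inj_on_subset)

lemma nat_points_eq: "nat_points = range real_vec"
proof (intro equalityI subsetI)
  fix x :: "real ^ 3" assume "x \<in> nat_points"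
  then have "\<forall>i. \<exists>n. x $ i = real n" by (auto simp: nat_points_def Nats_def)
  then obtain f where "\<And>i. x $ i = real (f i)" by metis
  then have "x = real_vec (f 1, f 2, f 3)" by (simp add: vec_eq_iff forall_3)
  then show "x \<in> range real_vec" by blast
qed (auto simp: nat_points_def forall_3)

lemma nat_points_subset_lattice_points: "nat_points \<subseteq> lattice_points"
  using Nats_subset_Ints by (auto simp: nat_points_def lattice_points_def)

lemma gap_point_in_hull:
  assumes "\<And>v. shifted_weight v \<le> 0 \<Longrightarrow> v \<in> S"
  shows "real_vec gap_point \<in> convex hull (distinct_sum_set 42 (real_vec ` S))"
proof -
  define s where "s = (\<Sum>m\<in>light_points. m)"
  have mem: "real_vec (s + ((2, 2, 1) + v)) \<in> distinct_sum_set 42 (real_vec ` S)"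
    if v: "v \<in> {(0, 5, 0), (1, 0, 3), (5, 1, 0)}" for v
  proof -
    let ?T = "light_points \<union> {(2, 2, 1), v}"
    have new: "light_points \<inter> {(2, 2, 1), v} = {}" "(2, 2, 1) \<noteq> v"
      using v by (auto simp: light_points_def shifted_weight_def)
    have "card ?T = 42" and "(\<Sum>m\<in>?T. m) = s + ((2, 2, 1) + v)"
      using new finite_light_points
      by (simp_all add: card_Un_disjoint sum.union_disjoint card_light_points s_def
          del: Un_insert_right)
    moreover have "?T \<subseteq> S"
    proof
      fix u assume "u \<in> ?T"
      then have "shifted_weight u \<le> 0" using v by (auto simp: light_points_def shifted_weight_def)
      then show "u \<in> S" by (rule assms)
    qed
    ultimately have "s + ((2, 2, 1) + v) \<in> distinct_sum_set 42 S"
      unfolding distinct_sum_set_def using finite_light_points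
      by (intro CollectI exI[of _ ?T]) auto
    then show ?thesis by (simp add: distinct_sum_set_real_vec)
  qed
  let ?p = "\<lambda>v. real_vec (s + ((2, 2, 1) + v))"
  have "real_vec gap_point =
      (1/3) *\<^sub>R ?p (0, 5, 0) + (1/3) *\<^sub>R ?p (1, 0, 3) + (1/3) *\<^sub>R ?p (5, 1, 0)"
    unfolding gap_point_def s_def[symmetric] real_vec_add
    by (simp add: vec_eq_iff forall_3 field_simps)
  then have "real_vec gap_point \<in> convex hull {?p (0, 5, 0), ?p (1, 0, 3), ?p (5, 1, 0)}"
    unfolding convex_hull_3
    by (intro CollectI exI[of _ "1/3"]) simp
  also have "\<dots> \<subseteq> convex hull (distinct_sum_set 42 (real_vec ` S))"
    using mem by (intro hull_mono) blast
  finally show ?thesis .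
qed

section \<open>Lattice points of the simplex\<close>

lemma lattice_points_simplex_subset:
  "(convex hull {vector [0, 0, 0], vector [0, 0, 6], vector [0, 6, 0], vector [6, 0, 0]}
     :: (real ^ 3) set) \<inter> lattice_points \<subseteq> nat_points"
proof
  fix x :: "real ^ 3"
  assume x: "x \<in> convex hull {vector [0, 0, 0], vector [0, 0, 6], vector [0, 6, 0],
    vector [6, 0, 0]} \<inter> lattice_points"
  have "convex {x :: real ^ 3. \<forall>i. 0 \<le> x $ i}"
    by (auto simp: convex_def)
  then have "convex hull {vector [0, 0, 0], vector [0, 0, 6], vector [0, 6, 0], vector [6, 0, 0]}
      \<subseteq> {x :: real ^ 3. \<forall>i. 0 \<le> x $ i}"
    by (intro hull_minimal) (auto simp: forall_3)
  then show "x \<in> nat_points"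
    using x by (auto simp: nat_points_def lattice_points_def Nats_altdef2)
qed

lemma real_vec_in_simplex:
  assumes "a + b + c \<le> 6"
  shows "real_vec (a, b, c)
    \<in> convex hull {vector [0, 0, 0], vector [0, 0, 6], vector [0, 6, 0], vector [6, 0, 0]}"
    (is "_ \<in> convex hull ?V")
proof -
  let ?u = "\<lambda>i::nat. [1 - real (a + b + c) / 6, real c / 6, real b / 6, real a / 6] ! i"
  let ?y = "\<lambda>i::nat. [vector [0, 0, 0], vector [0, 0, 6], vector [0, 6, 0], vector [6, 0, 0]] ! i
    :: real ^ 3"
  have "(\<Sum>i\<in>{0, 1, 2, 3}. ?u i *\<^sub>R ?y i) \<in> convex hull ?V"
    using assms by (intro convex_sum) (auto intro: hull_inc simp: field_simps)
  also have "(\<Sum>i\<in>{0, 1, 2, 3}. ?u i *\<^sub>R ?y i) = real_vec (a, b, c)"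
    by (simp add: vec_eq_iff forall_3)
  finally show ?thesis .
qed

theorem mainTheorem3:
  fixes P :: "(real ^ 3) set"
  assumes "P = convex hull {vector [0, 0, 0], vector [0, 0, 6], vector [0, 6, 0], vector [6, 0, 0]}"
  shows "(\<nexists>Q. lattice_polytope Q \<and>
             distinct_sum_set 42 (P \<inter> lattice_points) = Q \<inter> lattice_points) \<and>
         (\<exists>x \<in> convex hull (distinct_sum_set 42 (nat_points :: (real ^ 3) set)) \<inter> lattice_points.
             x \<notin> distinct_sum_set 42 nat_points)"
proof -
  let ?x = "real_vec gap_point"
  let ?D = "distinct_sum_set 42 (P \<inter> lattice_points)"
  let ?N = "distinct_sum_set 42 (nat_points :: (real ^ 3) set)"
  have sub: "?D \<subseteq> ?N"
    unfolding assms by (intro distinct_sum_set_mono lattice_points_simplex_subset)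
  have lat: "?x \<in> lattice_points"
    using nat_points_subset_lattice_points nat_points_eq by blast
  have notin: "?x \<notin> ?N"
    using gap_point_not_distinct_sum inj_real_vec
    by (auto simp: nat_points_eq distinct_sum_set_real_vec dest: injD)
  let ?S = "{v. shifted_weight v \<le> 0}"
  have "real_vec v \<in> P" if "v \<in> ?S" for v
  proof (cases v)
    case (fields a b c)
    then have "a + b + c \<le> 6" using that by (auto simp: shifted_weight_def)
    then show ?thesis unfolding assms fields by (rule real_vec_in_simplex)
  qed
  then have "real_vec ` ?S \<subseteq> P \<inter> lattice_points"
    using nat_points_subset_lattice_points nat_points_eq by blast
  then have "convex hull (distinct_sum_set 42 (real_vec ` ?S)) \<subseteq> convex hull ?D"
    by (intro hull_mono distinct_sum_set_mono)
  then have hull: "?x \<in> convex hull ?D"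
    using gap_point_in_hull[of ?S] by blast
  have "\<nexists>Q. lattice_polytope Q \<and> ?D = Q \<inter> lattice_points"
  proof
    assume "\<exists>Q. lattice_polytope Q \<and> ?D = Q \<inter> lattice_points"
    then obtain Q where Q: "lattice_polytope Q" "?D = Q \<inter> lattice_points" by blast
    have "convex Q" using Q(1) by (auto simp: lattice_polytope_def)
    then have "convex hull ?D \<subseteq> Q" using Q(2) by (intro hull_minimal) auto
    then have "?x \<in> ?D" using hull lat Q(2) by blast
    then show False using sub notin by blast
  qed
  moreover have "?x \<in> convex hull ?N \<inter> lattice_points"
    using hull hull_mono[OF sub] lat by blast
  ultimately show ?thesis using notin by blast
qed

end
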